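(* Let $q=2^r$ with $r\geq3$, let $m\ge1$ and put $N_2=(q-1)^m$. Then for every $h=1,2,\dots$, \[ MK^{mh}=\sum_{l=0}^{h-1}(-1)^{h+l+1}\binom{h}{l}(q-1)^{m(h-l)}MK^{ml} +q\sum_{j=0}^{\min\{(q-1)^m,h\}}(-1)^{h+j}D_{m,j}\sum_{t=j}^{h}t!\,S(h,t)\,2^{h-t}\binom{(q-1)^m-j}{(q-1)^m-t}. \] Moreover, \[ D_{m,j}=\sum\prod_{\beta\in\mathbb{F}_q}\binom{\sigma(m,q;\beta)}{\nu_\beta}, \] where the sum runs over all families of integers $\{\nu_\beta\}_{\beta\in\mathbb{F}_q}$ with $0\le\nu_\beta\le\sigma(m,q;\beta)$, $\sum_\beta\nu_\beta=j$ and $\sum_\beta\nu_\beta\beta=0$ (in $\mathbb{F}_q$), and \[ \sigma(m,q;\beta)=|\{(\alpha_1,\dots,\alpha_m)\in(\mathbb{F}_q^* )^m:\alpha_1+\cdots+\alpha_m+\alpha_1^{-1}+\cdots+\alpha_m^{-1}=\beta\}| =\sum\lambda(\alpha_1+\cdots+\alpha_m)+q^{-1}\{(q-1)^m+(-1)^{m+1}\}, \] the last sum running over all $\alpha_1,\dots,\alpha_m\in\mathbb{F}_q^*$ with $\alpha_1^{-1}+\cdots+\alpha_m^{-1}=\beta$.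
   Context: $\mathbb{F}_q$ is the finite field with $q=2^r$ elements, $tr$ the absolute trace to $\mathbb{F}_2$, and $\lambda(x)=(-1)^{tr(x)}$. For $a\in\mathbb{F}_q^*$, $K(\lambda;a)=\sum_{\alpha\in\mathbb{F}_q^*}\lambda(\alpha+a\alpha^{-1})$ is the Kloosterman sum, and for $h\ge0$, $MK^h=\sum_{a\in\mathbb{F}_q^*}K(\lambda;a)^h$. $S(h,t)=\frac{1}{t!}\sum_{j=0}^{t}(-1)^{t-j}\binom{t}{j}j^h$. Fix an ordering of $(\mathbb{F}_q^* )^m$ and let $w_m=(g_1,\dots,g_{N_2})\in\mathbb{F}_q^{N_2}$ with $g_i=\alpha_1+\cdots+\alpha_m+\alpha_1^{-1}+\cdots+\alpha_m^{-1}$ for the $i$-th tuple $(\alpha_1,\dots,\alpha_m)$. The binary linear code $D_m$ is $\{u\in\mathbb{F}_2^{N_2}:\sum_iu_ig_i=0\text{ in }\mathbb{F}_q\}$, and $D_{m,j}$ denotes the number of codewords of Hamming weight $j$ in $D_m$. *)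

theory Defs
  imports
    Complex_Main
    "HOL-Library.Z2"
    "HOL-Library.FuncSet"
    "HOL-Library.Cardinality"
    "HOL-Number_Theory.Residues"
    "HOL-Computational_Algebra.Primes"
begin

text \<open>
  The field with \<open>2^r\<close> elements is modelled by a type of class \<^class>\<open>finite_field\<close> with
  \<open>CARD('a) = 2^r\<close>. Its prime field is the type \<^typ>\<open>bit\<close>, which is embedded
  into \<open>'a\<close> by the library map \<open>of_bit\<close> (a field homomorphism exactly in characteristic 2).
\<close>

definition abs_trace :: "nat \<Rightarrow> 'a::finite_field \<Rightarrow> bit" where
  "abs_trace r x = (THE b. of_bit b = (\<Sum>i<r. x ^ (2 ^ i)))"

definition add_char :: "nat \<Rightarrow> 'a::finite_field \<Rightarrow> real" where
  "add_char r x = (- 1) ^ (of_bit (abs_trace r x) :: nat)"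

definition kloosterman :: "nat \<Rightarrow> 'a::finite_field \<Rightarrow> real" where
  "kloosterman r a = (\<Sum>\<alpha>\<in>UNIV - {0}. add_char r (\<alpha> + a * inverse \<alpha>))"

text \<open>The type argument selects the field over which the moment is taken.\<close>

definition MK :: "'a::finite_field itself \<Rightarrow> nat \<Rightarrow> nat \<Rightarrow> real" where
  "MK _ r h = (\<Sum>a\<in>UNIV - {0 :: 'a}. kloosterman r a ^ h)"

definition stirling_S :: "nat \<Rightarrow> nat \<Rightarrow> real" where
  "stirling_S h t = 1 / fact t * (\<Sum>j=0..t. (- 1) ^ (t - j) * real (t choose j) * real j ^ h)"

text \<open>
  Binomial coefficient with an integer lower argument, zero if that argument is negative;
  subtraction on \<^typ>\<open>nat\<close> would turn such a negative argument into \<open>0\<close>.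
\<close>

definition choose_int :: "nat \<Rightarrow> int \<Rightarrow> nat" where
  "choose_int n k = (if k < 0 then 0 else n choose nat k)"

definition unit_tuples :: "nat \<Rightarrow> (nat \<Rightarrow> 'a::finite_field) set" where
  "unit_tuples m = {1..m} \<rightarrow>\<^sub>E (UNIV - {0})"

definition tuple_sum :: "nat \<Rightarrow> (nat \<Rightarrow> 'a::finite_field) \<Rightarrow> 'a" where
  "tuple_sum m \<alpha> = (\<Sum>i=1..m. \<alpha> i) + (\<Sum>i=1..m. inverse (\<alpha> i))"

text \<open>Vectors of length \<open>N\<close> are extensional functions on \<open>{1..N}\<close>.\<close>

definition binary_code :: "nat \<Rightarrow> (nat \<Rightarrow> 'a::finite_field) \<Rightarrow> (nat \<Rightarrow> bit) set" where
  "binary_code N w = {u \<in> {1..N} \<rightarrow>\<^sub>E UNIV. (\<Sum>i=1..N. of_bit (u i) * w i) = 0}"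

definition hamming_weight :: "nat \<Rightarrow> (nat \<Rightarrow> bit) \<Rightarrow> nat" where
  "hamming_weight N u = card {i \<in> {1..N}. u i \<noteq> 0}"

text \<open>\<open>e\<close> is the chosen enumeration of \<open>unit_tuples m\<close> by \<open>{1..(q - 1)^m}\<close>.\<close>

definition code_D :: "(nat \<Rightarrow> nat \<Rightarrow> 'a::finite_field) \<Rightarrow> nat \<Rightarrow> (nat \<Rightarrow> bit) set" where
  "code_D e m = binary_code ((CARD('a) - 1) ^ m) (\<lambda>i. tuple_sum m (e i))"

definition D_count :: "(nat \<Rightarrow> nat \<Rightarrow> 'a::finite_field) \<Rightarrow> nat \<Rightarrow> nat \<Rightarrow> nat" where
  "D_count e m j = card {u \<in> code_D e m. hamming_weight ((CARD('a) - 1) ^ m) u = j}"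

definition sigma :: "nat \<Rightarrow> 'a::finite_field \<Rightarrow> nat" where
  "sigma m \<beta> = card {\<alpha> \<in> unit_tuples m. tuple_sum m \<alpha> = \<beta>}"

text \<open>The value of \<open>abs_trace\<close> is well defined.\<close>

lemma CHAR_eq_2:
  assumes "CARD('a::finite_field) = 2 ^ r"
  shows "CHAR('a) = 2"
proof -
  have "prime CHAR('a)"
    by (simp add: prime_CHAR_semidom finite_imp_CHAR_pos)
  moreover have "CHAR('a) dvd CARD('a)"
    by (rule CHAR_dvd_CARD)
  ultimately show ?thesis
    using assms by (metis prime_dvd_power primes_dvd_imp_eq two_is_prime_nat)
qed

lemma of_bit_abs_trace:
  fixes x :: "'a::finite_field"
  assumes card: "CARD('a) = 2 ^ r"
  shows "of_bit (abs_trace r x) = (\<Sum>i<r. x ^ (2 ^ i))"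
proof -
  let ?y = "\<Sum>i<r. x ^ (2 ^ i)"
  have add_sq: "(a + b)\<^sup>2 = a\<^sup>2 + b\<^sup>2" for a b :: 'a
    by (rule freshmans_dream) (simp_all only: CHAR_eq_2[OF card] two_is_prime_nat)
  have sq: "(\<Sum>i<n. x ^ (2 ^ i))\<^sup>2 = (\<Sum>i<n. x ^ (2 ^ Suc i))" for n
  proof (induction n)
    case (Suc n)
    have "(x ^ (2 ^ n))\<^sup>2 = x ^ (2 ^ Suc n)"
      by (metis power_mult power_Suc2)
    with Suc show ?case
      by (simp only: sum.lessThan_Suc add_sq)
  qed simp
  have "(\<Sum>i<Suc r. x ^ (2 ^ i)) = x + ?y\<^sup>2"
    unfolding sq by (subst sum.lessThan_Suc_shift) simp
  moreover have "(\<Sum>i<Suc r. x ^ (2 ^ i)) = ?y + x"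
    using finite_field_power_card_eq_same[of x] card by simp
  ultimately have "?y\<^sup>2 = ?y"
    by (metis add.commute add_left_cancel)
  then have "?y = 0 \<or> ?y = 1"
    by (simp add: power2_eq_square)
  then have "\<exists>b. of_bit b = ?y"
  proof
    assume "?y = 0"
    then show ?thesis by (intro exI[of _ 0]) simp
  next
    assume "?y = 1"
    then show ?thesis by (intro exI[of _ 1]) simp
  qed
  then obtain b where b: "of_bit b = ?y" ..
  moreover have "c = b" if "of_bit c = ?y" for c
    using that b by (cases c; cases b; simp flip: b)
  ultimately have "abs_trace r x = b"
    unfolding abs_trace_def by (intro the_equality)
  with b show ?thesis by simp
qed

end

theory Submission
  imports Defs "HOL-Computational_Algebra.Polynomial"
begin

text \<open>
  Let \<open>g\<^sub>1, \<dots>, g\<^sub>N\<close> be the entries of the vector \<open>w\<^sub>m\<close>, and for \<open>a\<close> in the field let \<open>w(a)\<close> be the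
  weight of the binary word \<open>(tr (a g\<^sub>1), \<dots>, tr (a g\<^sub>N))\<close>. Then \<open>N - 2 w(a) = \<Sum>\<^sub>i \<lambda>(a g\<^sub>i)\<close>, which is
  \<open>N\<close> for \<open>a = 0\<close> and \<open>K(\<lambda>;a\<^sup>2)\<^sup>m = K(\<lambda>;a)\<^sup>m\<close> otherwise. Summing \<open>(2 w(a))\<^sup>h\<close> over all \<open>a\<close>
  gives the moments \<open>MK\<^sup>m\<^sup>l\<close> by the binomial theorem on the one hand, and the numbers \<open>D\<^sub>m\<^sub>,\<^sub>j\<close> by the
  Pless power moment identity on the other. That identity is proved by character orthogonality for
  the family indexed by \<open>a\<close>, so it does not matter whether \<open>a\<close> is determined by its word.
\<close>

section \<open>Arithmetic in characteristic 2\<close>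

lemma CHAR_2_add_self:
  fixes x :: "'a::finite_field"
  assumes "CARD('a) = 2 ^ r"
  shows "x + x = 0"
proof -
  have "of_nat CHAR('a) * x = 0"
    by simp
  then show ?thesis
    unfolding CHAR_eq_2[OF assms] by simp
qed

text \<open>In characteristic 2 the two square roots \<open>y\<close> and \<open>- y\<close>
  coincide, so squaring is injective, and on a finite set it is then surjective. This justifies
  substituting squares in a Kloosterman sum.\<close>

lemma bij_betw_square_units:
  assumes "CARD('a::finite_field) = 2 ^ r"
  shows "bij_betw (\<lambda>x. x\<^sup>2) (UNIV - {0 :: 'a}) (UNIV - {0})"
proof -
  have "inj_on (\<lambda>x. x\<^sup>2) (UNIV - {0 :: 'a})"
  proof (rule inj_onI)
    fix x y :: 'a
    assume "x\<^sup>2 = y\<^sup>2"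
    then have "x = y \<or> x = - y"
      by (simp add: power2_eq_iff)
    then show "x = y"
      using minus_unique[OF CHAR_2_add_self[OF assms, of y]] by auto
  qed
  moreover have "(\<lambda>x. x\<^sup>2) ` (UNIV - {0 :: 'a}) \<subseteq> UNIV - {0}"
    by auto
  ultimately show ?thesis
    by (simp add: bij_betw_def endo_inj_surj)
qed

subsection \<open>The additive character\<close>

lemma add_char_alt: "add_char r x = (if abs_trace r x = 0 then 1 else - 1)"
  by (cases "abs_trace r x") (simp_all add: add_char_def)

lemma add_char_cases: "add_char r x = 1 \<or> add_char r x = - 1"
  by (simp add: add_char_alt)

lemma of_bit_abs_trace_add:
  fixes x y :: "'a::finite_field"
  assumes card: "CARD('a) = 2 ^ r"
  shows "(of_bit (abs_trace r (x + y)) :: 'a)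
    = of_bit (abs_trace r x) + of_bit (abs_trace r y)"
  unfolding of_bit_abs_trace[OF card]
  by (subst freshmans_dream'[where m = "2 ^ i" and n = i for i])
     (simp_all add: CHAR_eq_2[OF card] sum.distrib)

lemma add_char_add:
  fixes x y :: "'a::finite_field"
  assumes card: "CARD('a) = 2 ^ r"
  shows "add_char r (x + y) = add_char r x * add_char r y"
  \<comment> \<open>Additivity of the trace is known only for the images in the field;
    \<open>1 + 1 = 0\<close> there excludes the incompatible combinations of bits.\<close>
  using of_bit_abs_trace_add[OF card, of x y] CHAR_2_add_self[OF card, of 1]
  by (cases "abs_trace r (x + y)"; cases "abs_trace r x"; cases "abs_trace r y")
     (simp_all add: add_char_alt)

lemma add_char_0:
  assumes card: "CARD('a::finite_field) = 2 ^ r"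
  shows "add_char r (0 :: 'a) = 1"
  using add_char_add[OF card, of 0 0] add_char_cases[of r "0 :: 'a"] by auto

lemma add_char_sum:
  fixes f :: "'b \<Rightarrow> 'a::finite_field"
  assumes card: "CARD('a) = 2 ^ r"
  shows "add_char r (sum f A) = (\<Prod>i\<in>A. add_char r (f i))"
  by (induction A rule: infinite_finite_induct) (simp_all add: add_char_0[OF card] add_char_add[OF card])

text \<open>Frobenius is additive, so the trace of a square is the square of the trace, and 0 and 1
  are their own squares.\<close>

lemma add_char_square:
  fixes x :: "'a::finite_field"
  assumes card: "CARD('a) = 2 ^ r"
  shows "add_char r (x\<^sup>2) = add_char r x"
proof -
  let ?t = "\<lambda>x. of_bit (abs_trace r x) :: 'a"
  have "?t (x\<^sup>2) = (\<Sum>i<r. (x ^ 2 ^ i)\<^sup>2)"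
    unfolding of_bit_abs_trace[OF card]
    by (rule sum.cong) (simp_all flip: power_mult add: mult.commute)
  also have "\<dots> = (\<Sum>i<r. x ^ 2 ^ i)\<^sup>2"
    by (rule freshmans_dream_sum[symmetric]) (simp_all add: CHAR_eq_2[OF card])
  also have "\<dots> = ?t x ^ 2"
    unfolding of_bit_abs_trace[OF card] ..
  finally show ?thesis
    by (cases "abs_trace r x"; cases "abs_trace r (x\<^sup>2)") (simp_all add: add_char_alt)
qed

text \<open>The trace is a nonzero polynomial of degree at most \<open>2 ^ (r - 1) < CARD('a)\<close>, so it cannot
  vanish identically.\<close>

lemma exists_add_char_eq_minus_1:
  assumes card: "CARD('a::finite_field) = 2 ^ r" and "r \<ge> 1"
  obtains x :: "'a::finite_field" where "add_char r x = - 1"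
proof -
  define p :: "'a poly" where "p = (\<Sum>i<r. monom 1 (2 ^ i))"
  have poly_p: "poly p x = of_bit (abs_trace r x)" for x
    unfolding of_bit_abs_trace[OF card] by (simp add: p_def poly_sum poly_monom)
  \<comment> \<open>Only \<open>i = 0\<close> has exponent \<open>2 ^ i = 1\<close>, so the linear
    coefficient is 1 and \<open>p\<close> is not the zero polynomial.\<close>
  have "coeff p 1 = (\<Sum>i<r. if i = 0 then 1 else 0)"
    unfolding p_def coeff_sum by (rule sum.cong) auto
  then have "p \<noteq> 0"
    using \<open>r \<ge> 1\<close> by auto
  have "degree p \<le> 2 ^ (r - 1)"
    unfolding p_def
    by (rule degree_sum_le) (auto simp: degree_monom_eq intro!: power_increasing)
  also have "\<dots> < (2 :: nat) ^ r"
    using \<open>r \<ge> 1\<close> by (intro power_strict_increasing) auto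
  finally have "card {x. poly p x = 0} < CARD('a)"
    using card_poly_roots_bound[OF \<open>p \<noteq> 0\<close>] card by simp
  then have "{x. poly p x = 0} \<noteq> UNIV"
    by auto
  then obtain x where "poly p x \<noteq> 0"
    by blast
  then show ?thesis
    by (intro that[of x]) (auto simp: poly_p add_char_alt)
qed

text \<open>Character orthogonality. For \<open>b \<noteq> 0\<close>, shifting \<open>a\<close> by
  \<open>x / b\<close> with \<open>add_char r x = - 1\<close> negates every summand, so the sum
  equals its own negative.\<close>

lemma sum_add_char_mult:
  fixes b :: "'a::finite_field"
  assumes card: "CARD('a) = 2 ^ r" and "r \<ge> 1"
  shows "(\<Sum>a\<in>UNIV. add_char r (a * b)) = (if b = 0 then 2 ^ r else 0)"
proof (cases "b = 0")
  case True
  then show ?thesis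
    using card by (simp add: add_char_0[OF card])
next
  case False
  obtain x :: 'a where x: "add_char r x = - 1"
    using exists_add_char_eq_minus_1[OF assms] .
  have "(\<Sum>a\<in>UNIV. add_char r (a * b)) = (\<Sum>a\<in>UNIV. add_char r ((a + x / b) * b))"
    by (rule sum.reindex_bij_witness[of _ "\<lambda>a. a + x / b" "\<lambda>a. a - x / b"]) auto
  also have "\<dots> = - (\<Sum>a\<in>UNIV. add_char r (a * b))"
    using False by (simp add: distrib_right add_char_add[OF card] x sum_negf)
  finally show ?thesis
    using False by simp
qed

lemma sum_add_char_units:
  assumes card: "CARD('a::finite_field) = 2 ^ r" and "r \<ge> 1"
  shows "(\<Sum>x\<in>UNIV - {0 :: 'a}. add_char r x) = - 1"
  using sum_add_char_mult[OF assms, of 1] add_char_0[OF card]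
  by (simp add: sum_diff1)

subsection \<open>Kloosterman sums\<close>

text \<open>Replacing \<open>\<alpha>\<close> by its square turns the argument into the square of
  \<open>\<alpha> + a * inverse \<alpha>\<close>, and the character does not distinguish an element
  from its square.\<close>

lemma kloosterman_square:
  fixes a :: "'a::finite_field"
  assumes card: "CARD('a) = 2 ^ r"
  shows "kloosterman r (a\<^sup>2) = kloosterman r a"
proof -
  have "kloosterman r (a\<^sup>2) = (\<Sum>\<alpha>\<in>UNIV - {0}. add_char r (\<alpha>\<^sup>2 + a\<^sup>2 * inverse (\<alpha>\<^sup>2)))"
    unfolding kloosterman_def
    by (rule sum.reindex_bij_betw[OF bij_betw_square_units[OF card], symmetric])
  also have "\<dots> = (\<Sum>\<alpha>\<in>UNIV - {0}. add_char r ((\<alpha> + a * inverse \<alpha>)\<^sup>2))"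
    by (subst freshmans_dream) (simp_all add: CHAR_eq_2[OF card] power_mult_distrib power_inverse)
  finally show ?thesis
    by (simp add: add_char_square[OF card] kloosterman_def)
qed

text \<open>The substitution of \<open>a * \<alpha>\<close> for the summation variable gives the
  Kloosterman sum at \<open>a\<^sup>2\<close>, which equals the one at \<open>a\<close>.\<close>

lemma sum_add_char_add_inverse:
  fixes a :: "'a::finite_field"
  assumes card: "CARD('a) = 2 ^ r" and "a \<noteq> 0"
  shows "(\<Sum>\<alpha>\<in>UNIV - {0}. add_char r (a * (\<alpha> + inverse \<alpha>))) = kloosterman r a"
proof -
  have "(\<Sum>\<alpha>\<in>UNIV - {0}. add_char r (a * (\<alpha> + inverse \<alpha>))) = kloosterman r (a\<^sup>2)"
    unfolding kloosterman_def
    by (rule sum.reindex_bij_witness[of _ "\<lambda>\<alpha>. \<alpha> / a" "\<lambda>\<alpha>. a * \<alpha>"])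
       (use \<open>a \<noteq> 0\<close> in \<open>auto simp: field_simps power2_eq_square\<close>)
  then show ?thesis
    by (simp add: kloosterman_square[OF card])
qed

text \<open>This degenerate value produces the term \<open>(- 1) ^ m\<close> in the evaluation of
  \<open>sigma\<close>.\<close>

lemma kloosterman_0:
  assumes "CARD('a::finite_field) = 2 ^ r" and "r \<ge> 1"
  shows "kloosterman r (0 :: 'a) = - 1"
  by (simp add: kloosterman_def sum_add_char_units[OF assms])

section \<open>Sums over tuples of nonzero elements\<close>

lemma sum_unit_tuples_prod:
  fixes f :: "'a::finite_field \<Rightarrow> real"
  shows "(\<Sum>\<alpha>\<in>unit_tuples m. \<Prod>i=1..m. f (\<alpha> i)) = (\<Sum>x\<in>UNIV - {0}. f x) ^ m"
  unfolding unit_tuples_def by (subst prod_sum_PiE[symmetric]) simp_all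

lemma finite_unit_tuples [simp]: "finite (unit_tuples m)"
  unfolding unit_tuples_def by (intro finite_PiE) simp_all

lemma card_unit_tuples:
  "card (unit_tuples m :: (nat \<Rightarrow> 'a::finite_field) set) = (CARD('a) - 1) ^ m"
  unfolding unit_tuples_def by (subst card_PiE) (simp_all add: card_Diff_subset)

lemma sum_unit_tuples_add_char_mult_tuple_sum:
  fixes a :: "'a::finite_field"
  assumes card: "CARD('a) = 2 ^ r" and "a \<noteq> 0"
  shows "(\<Sum>\<alpha>\<in>unit_tuples m. add_char r (a * tuple_sum m \<alpha>)) = kloosterman r a ^ m"
proof -
  have "(\<Sum>\<alpha>\<in>unit_tuples m. add_char r (a * tuple_sum m \<alpha>))
      = (\<Sum>\<alpha>\<in>unit_tuples m. \<Prod>i=1..m. add_char r (a * (\<alpha> i + inverse (\<alpha> i))))"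
    unfolding tuple_sum_def sum.distrib[symmetric] sum_distrib_left add_char_sum[OF card] ..
  then show ?thesis
    using sum_unit_tuples_prod[where f = "\<lambda>x. add_char r (a * (x + inverse x))"]
    by (simp only: sum_add_char_add_inverse[OF assms])
qed

text \<open>By orthogonality, \<open>2 ^ r\<close> times either sum is a sum over all
  \<open>a\<close> in the field, and the two agree for \<open>a \<noteq> 0\<close>. The correction
  is the difference of the terms at \<open>a = 0\<close>: \<open>(2 ^ r - 1) ^ m\<close> for
  \<open>sigma\<close> and \<open>(- 1) ^ m\<close>, from the Kloosterman sum at 0, for the
  character sum.\<close>

lemma sigma_eq_sum_add_char:
  fixes \<beta> :: "'a::finite_field"
  assumes card: "CARD('a) = 2 ^ r" and r: "r \<ge> 1"
  shows "real (sigma m \<beta>) =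
    (\<Sum>\<alpha> | \<alpha> \<in> unit_tuples m \<and> (\<Sum>i=1..m. inverse (\<alpha> i)) = \<beta>.
       add_char r (\<Sum>i=1..m. \<alpha> i))
    + inverse (2 ^ r) * ((2 ^ r - 1) ^ m + (- 1) ^ (m + 1))"
    (is "_ = ?S + _")
proof -
  have eq_iff: "x + \<beta> = 0 \<longleftrightarrow> x = \<beta>" for x
    using CHAR_2_add_self[OF card, of \<beta>] by (metis add_right_cancel)
  define M where "M = (\<Sum>a\<in>UNIV - {0 :: 'a}. add_char r (a * \<beta>) * kloosterman r a ^ m)"
  have "2 ^ r * real (sigma m \<beta>)
      = (\<Sum>\<alpha>\<in>unit_tuples m. if tuple_sum m \<alpha> + \<beta> = 0 then 2 ^ r else 0)"
    by (simp add: sigma_def eq_iff sum.If_cases Int_def conj_commute)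
  also have "\<dots> = (\<Sum>\<alpha>\<in>unit_tuples m. \<Sum>a\<in>UNIV. add_char r (a * (tuple_sum m \<alpha> + \<beta>)))"
    unfolding sum_add_char_mult[OF assms] ..
  also have "\<dots> = (\<Sum>a\<in>UNIV. add_char r (a * \<beta>)
      * (\<Sum>\<alpha>\<in>unit_tuples m. add_char r (a * tuple_sum m \<alpha>)))"
    by (subst sum.swap)
       (simp add: distrib_left add_char_add[OF card] sum_distrib_left mult.commute)
  also have "\<dots> = real ((2 ^ r - 1) ^ m) + M"
    unfolding M_def
    by (subst sum.remove[of _ 0])
       (auto simp: add_char_0[OF card] card_unit_tuples card
          sum_unit_tuples_add_char_mult_tuple_sum[OF card])
  finally have sigma: "2 ^ r * real (sigma m \<beta>) = (2 ^ r - 1) ^ m + M"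
    by simp
  have "2 ^ r * ?S = (\<Sum>\<alpha>\<in>unit_tuples m.
      add_char r (\<Sum>i=1..m. \<alpha> i) * (if (\<Sum>i=1..m. inverse (\<alpha> i)) + \<beta> = 0 then 2 ^ r else 0))"
    by (simp add: eq_iff sum.If_cases Int_def sum_distrib_left mult.commute
        if_distrib[of "\<lambda>x. _ * x"] cong: if_cong)
  also have "\<dots> = (\<Sum>\<alpha>\<in>unit_tuples m. add_char r (\<Sum>i=1..m. \<alpha> i)
      * (\<Sum>a\<in>UNIV. add_char r (a * ((\<Sum>i=1..m. inverse (\<alpha> i)) + \<beta>))))"
    unfolding sum_add_char_mult[OF assms] ..
  \<comment> \<open>Here \<open>a\<close> multiplies only the inverses, so each coordinate
    contributes a summand of the Kloosterman sum at \<open>a\<close> itself, also for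
    \<open>a = 0\<close>.\<close>
  also have "\<dots> = (\<Sum>\<alpha>\<in>unit_tuples m. \<Sum>a\<in>UNIV. add_char r (a * \<beta>)
      * (\<Prod>i=1..m. add_char r (\<alpha> i + a * inverse (\<alpha> i))))"
    by (simp add: distrib_left add_char_add[OF card] sum_distrib_left add_char_sum[OF card]
        prod.distrib mult_ac)
  also have "\<dots> = (\<Sum>a\<in>UNIV. add_char r (a * \<beta>) * kloosterman r a ^ m)"
    unfolding kloosterman_def
    by (subst sum.swap)
       (simp only: sum_unit_tuples_prod[where f = "\<lambda>x. add_char r (x + a * inverse x)" for a]
          sum_distrib_left[symmetric])
  also have "\<dots> = (- 1) ^ m + M"
    unfolding M_def
    by (subst sum.remove[of _ 0]) (auto simp: add_char_0[OF card] kloosterman_0[OF assms])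
  finally have S: "2 ^ r * ?S = (- 1) ^ m + M" .
  have "2 ^ r * real (sigma m \<beta>) = 2 ^ r * ?S + ((2 ^ r - 1) ^ m + (- 1) ^ (m + 1))"
    unfolding sigma S by simp
  then show ?thesis
    by (simp add: field_simps)
qed

subsection \<open>Stirling numbers\<close>

text \<open>The product \<open>fact t * stirling_S h t\<close>, the number of surjections from an
  \<open>h\<close>-set onto a \<open>t\<close>-set, is kept together to avoid divisions.\<close>

lemma fact_mult_stirling_S:
  "fact t * stirling_S h t = (\<Sum>j\<le>t. (- 1) ^ (t - j) * real (t choose j) * real j ^ h)"
  by (simp add: stirling_S_def atLeast0AtMost)

lemma fact_mult_stirling_S_0: "fact t * stirling_S 0 t = (if t = 0 then 1 else 0)"
  \<comment> \<open>For exponent 0 the alternating sum is the expansion of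
    \<open>(1 - 1) ^ t\<close>.\<close>
  using binomial_ring[of 1 "- 1 :: real" t]
  by (simp add: fact_mult_stirling_S mult.commute power_0_left)

lemma stirling_S_Suc_0: "stirling_S (Suc h) 0 = 0"
  by (simp add: stirling_S_def)

text \<open>The Stirling recurrence, obtained summand by summand by absorbing one factor
  \<open>j\<close> into the binomial coefficient and then applying Pascal's rule.\<close>

lemma fact_mult_stirling_S_Suc_Suc:
  "fact (Suc t) * stirling_S (Suc h) (Suc t)
    = real (Suc t) * (fact (Suc t) * stirling_S h (Suc t) + fact t * stirling_S h t)"
proof -
  \<comment> \<open>The conditional isolates \<open>j = Suc t\<close>, where
    \<open>t choose j\<close> vanishes and the subtraction \<open>t - j\<close> is
    truncated.\<close>
  have absorb: "(- 1) ^ (Suc t - j) * real (Suc t choose j) * real j ^ Suc h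
      = real (Suc t) * ((- 1) ^ (Suc t - j) * real (Suc t choose j) * real j ^ h
        + (if j \<le> t then (- 1) ^ (t - j) * real (t choose j) * real j ^ h else 0))"
    if "j \<le> Suc t" for j
  proof -
    have "real j * real (Suc t choose j) = real (Suc t) * (real (Suc t choose j) - real (t choose j))"
    proof (cases j)
      case (Suc k)
      have "Suc k * (Suc t choose Suc k) = Suc t * (t choose k)"
        by (rule Suc_times_binomial)
      then have "real (Suc k) * real (Suc t choose Suc k) = real (Suc t) * real (t choose k)"
        by (metis of_nat_mult)
      then show ?thesis
        using Suc by simp
    qed simp
    then have "(- 1) ^ (Suc t - j) * real (Suc t choose j) * real j ^ Suc h
      = (- 1) ^ (Suc t - j) * real j ^ h * (real (Suc t) * (real (Suc t choose j) - real (t choose j)))"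
      by (simp add: mult_ac)
    also have "\<dots> = real (Suc t) * ((- 1) ^ (Suc t - j) * real (Suc t choose j) * real j ^ h
        - (- 1) ^ (Suc t - j) * real (t choose j) * real j ^ h)"
      by (simp only: right_diff_distrib mult_ac)
    also have "(- 1) ^ (Suc t - j) * real (t choose j) * real j ^ h
      = - (if j \<le> t then (- 1) ^ (t - j) * real (t choose j) * real j ^ h else 0)"
      using that by (simp add: Suc_diff_le)
    finally show ?thesis
      by simp
  qed
  have "fact (Suc t) * stirling_S (Suc h) (Suc t)
      = (\<Sum>j\<le>Suc t. real (Suc t) * ((- 1) ^ (Suc t - j) * real (Suc t choose j) * real j ^ h
        + (if j \<le> t then (- 1) ^ (t - j) * real (t choose j) * real j ^ h else 0)))"
    unfolding fact_mult_stirling_S using absorb by (intro sum.cong) auto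
  also have "\<dots> = real (Suc t) * ((\<Sum>j\<le>Suc t. (- 1) ^ (Suc t - j) * real (Suc t choose j) * real j ^ h)
        + (\<Sum>j\<le>Suc t. if j \<le> t then (- 1) ^ (t - j) * real (t choose j) * real j ^ h else 0))"
    unfolding sum.distrib[symmetric] sum_distrib_left ..
  also have "(\<Sum>j\<le>Suc t. if j \<le> t then (- 1) ^ (t - j) * real (t choose j) * real j ^ h else 0)
      = (\<Sum>j\<le>t. (- 1) ^ (t - j) * real (t choose j) * real j ^ h)"
    by (simp only: sum.atMost_Suc) simp
  finally show ?thesis
    unfolding fact_mult_stirling_S .
qed

lemma stirling_S_eq_0: "h < t \<Longrightarrow> stirling_S h t = 0"
proof (induction h arbitrary: t)
  case 0
  then show ?case
    using fact_mult_stirling_S_0[of t] by simp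
next
  case (Suc h)
  then obtain t' where "t = Suc t'" "h < t'"
    using less_imp_Suc_add by (cases t) auto
  then have "fact (Suc t') * stirling_S (Suc h) t = 0"
    using Suc.IH[of t'] Suc.IH[of "Suc t'"] fact_mult_stirling_S_Suc_Suc[of t' h] by simp
  then show ?case
    by simp
qed

text \<open>Rewriting powers in the basis of binomial coefficients reduces power moments to binomial
  moments. Multiplication by \<open>n\<close> sends \<open>n choose t\<close> to a combination of
  \<open>n choose t\<close> and \<open>n choose Suc t\<close>, which matches the Stirling
  recurrence.\<close>

lemma power_eq_sum_stirling_S:
  "real n ^ h = (\<Sum>t\<le>h. fact t * stirling_S h t * real (n choose t))"
proof (induction h)
  case 0
  show ?case
    using fact_mult_stirling_S_0[of 0] by simp
next
  case (Suc h)
  have absorb: "real n * real (n choose t) = real t * real (n choose t) + real (Suc t) * real (n choose Suc t)" for t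
  proof (cases "t \<le> n")
    case True
    have "Suc t * (n choose Suc t) = (n - t) * (n choose t)"
      using binomial_absorb_comp[of n t] binomial_absorption[of t n] by simp
    then have "real (Suc t) * real (n choose Suc t) = (real n - real t) * real (n choose t)"
      using True by (metis of_nat_mult of_nat_diff)
    then show ?thesis
      by (simp add: algebra_simps)
  qed (simp add: binomial_eq_0)
  let ?A = "\<lambda>h t. fact t * stirling_S h t"
  have "real n ^ Suc h = (\<Sum>t\<le>h. ?A h t * (real n * real (n choose t)))"
    by (simp add: Suc.IH sum_distrib_left mult_ac)
  also have "\<dots> = (\<Sum>t\<le>h. ?A h t * real t * real (n choose t))
      + (\<Sum>t\<le>h. ?A h t * real (Suc t) * real (n choose Suc t))"
    unfolding absorb distrib_left sum.distrib by (simp only: mult.assoc)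
  \<comment> \<open>The added term at \<open>t = Suc h\<close> is zero because \<open>h < t\<close>;
    in the index shift that follows, the term at \<open>t = 0\<close> is zero because of the factor
    \<open>t\<close>.\<close>
  also have "(\<Sum>t\<le>h. ?A h t * real t * real (n choose t))
      = (\<Sum>t\<le>Suc h. ?A h t * real t * real (n choose t))"
    by (simp add: stirling_S_eq_0)
  also have "\<dots> = (\<Sum>t\<le>h. ?A h (Suc t) * real (Suc t) * real (n choose Suc t))"
    unfolding sum.atMost_Suc_shift by simp
  also have "\<dots> + (\<Sum>t\<le>h. ?A h t * real (Suc t) * real (n choose Suc t))
      = (\<Sum>t\<le>h. ?A (Suc h) (Suc t) * real (n choose Suc t))"
    unfolding fact_mult_stirling_S_Suc_Suc sum.distrib[symmetric]
    by (intro sum.cong refl) (simp only: distrib_left distrib_right mult_ac)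
  also have "\<dots> = (\<Sum>t\<le>Suc h. ?A (Suc h) t * real (n choose t))"
    unfolding sum.atMost_Suc_shift by (simp add: stirling_S_Suc_0)
  finally show ?case .
qed

subsection \<open>Subsets with vanishing sum\<close>

text \<open>Complements \<open>I - T\<close> are the subsets of \<open>I - U\<close> of size
  \<open>card I - t\<close>. The integer lower argument makes the count 0 for
  \<open>t > card I\<close>.\<close>

lemma card_intermediate_subsets:
  assumes "finite I" and "U \<subseteq> I"
  shows "card {T. U \<subseteq> T \<and> T \<subseteq> I \<and> card T = t}
    = choose_int (card I - card U) (int (card I) - int t)"
proof (cases "t \<le> card I")
  case True
  have card_compl: "card (I - V) = t" if "V \<subseteq> I - U" "card V = card I - t" for V
    using that assms True by (subst card_Diff_subset) (auto intro: finite_subset)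
  have "bij_betw (\<lambda>T. I - T) {T. U \<subseteq> T \<and> T \<subseteq> I \<and> card T = t} {V. V \<subseteq> I - U \<and> card V = card I - t}"
    by (rule bij_betwI[where g = "\<lambda>V. I - V"])
       (use assms True in \<open>auto simp: card_compl card_Diff_subset finite_subset double_diff\<close>)
  then have "card {T. U \<subseteq> T \<and> T \<subseteq> I \<and> card T = t} = card {V. V \<subseteq> I - U \<and> card V = card I - t}"
    by (rule bij_betw_same_card)
  also have "\<dots> = card (I - U) choose (card I - t)"
    using assms by (intro n_subsets) simp
  finally show ?thesis
    using assms True by (simp add: choose_int_def card_Diff_subset finite_subset nat_diff_distrib)
next
  case False
  have "card T \<noteq> t" if "T \<subseteq> I" for T
    using False card_mono[OF \<open>finite I\<close> that] by linarith
  then have "{T. U \<subseteq> T \<and> T \<subseteq> I \<and> card T = t} = {}"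
    by blast
  with False show ?thesis
    by (simp only: choose_int_def) simp
qed

text \<open>Subsets are sorted by their profile \<open>\<nu>\<close>, the number of elements in each
  fibre of \<open>g\<close>. Size and sum depend only on the profile, and a subset with a given
  profile is an independent choice inside every fibre.\<close>

lemma card_zero_sum_subsets:
  fixes g :: "'i \<Rightarrow> 'a::finite_field"
  assumes "finite I"
  shows "card {U. U \<subseteq> I \<and> card U = j \<and> sum g U = 0}
    = (\<Sum>\<nu> | (\<forall>\<beta>. \<nu> \<beta> \<le> card {i \<in> I. g i = \<beta>}) \<and> (\<Sum>\<beta>\<in>UNIV. \<nu> \<beta>) = j
          \<and> (\<Sum>\<beta>\<in>UNIV. of_nat (\<nu> \<beta>) * \<beta>) = (0 :: 'a).
        \<Prod>\<beta>\<in>UNIV. card {i \<in> I. g i = \<beta>} choose \<nu> \<beta>)"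
proof -
  let ?fib = "\<lambda>U \<beta>. {i \<in> U. g i = \<beta>}"
  let ?Z = "{U. U \<subseteq> I \<and> card U = j \<and> sum g U = 0}"
  let ?N = "{\<nu>. (\<forall>\<beta>. \<nu> \<beta> \<le> card (?fib I \<beta>)) \<and> (\<Sum>\<beta>\<in>UNIV. \<nu> \<beta>) = j
          \<and> (\<Sum>\<beta>\<in>UNIV. of_nat (\<nu> \<beta>) * \<beta>) = 0}"
  have fin: "finite U" if "U \<subseteq> I" for U
    using that assms by (rule finite_subset)
  have sum_fib: "(\<Sum>\<beta>\<in>UNIV. card (?fib U \<beta>)) = card U" "(\<Sum>\<beta>\<in>UNIV. of_nat (card (?fib U \<beta>)) * \<beta>) = sum g U"
    if "U \<subseteq> I" for U
    using sum_fun_comp[of U UNIV g "\<lambda>_. 1 :: nat"] sum_fun_comp[of U UNIV g "\<lambda>\<beta>. \<beta>"] fin[OF that]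
    by simp_all
  have fibre: "card {U \<in> ?Z. (\<lambda>\<beta>. card (?fib U \<beta>)) = \<nu>} = (\<Prod>\<beta>\<in>UNIV. card (?fib I \<beta>) choose \<nu> \<beta>)"
    if "\<nu> \<in> ?N" for \<nu>
  proof -
    let ?P = "\<Pi>\<^sub>E \<beta>\<in>UNIV. {V. V \<subseteq> ?fib I \<beta> \<and> card V = \<nu> \<beta>}"
    have "{U \<in> ?Z. (\<lambda>\<beta>. card (?fib U \<beta>)) = \<nu>} = {U. U \<subseteq> I \<and> (\<forall>\<beta>. card (?fib U \<beta>) = \<nu> \<beta>)}"
      using that by (auto simp: fun_eq_iff simp flip: sum_fib)
    moreover have "bij_betw (\<lambda>U. ?fib U) {U. U \<subseteq> I \<and> (\<forall>\<beta>. card (?fib U \<beta>) = \<nu> \<beta>)} ?P"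
    proof (rule bij_betwI[where g = "\<lambda>V. \<Union>\<beta>. V \<beta>"])
      show "(\<lambda>V. \<Union>\<beta>. V \<beta>) \<in> ?P \<rightarrow> {U. U \<subseteq> I \<and> (\<forall>\<beta>. card (?fib U \<beta>) = \<nu> \<beta>)}"
      proof (rule funcsetI)
        fix V assume V: "V \<in> ?P"
        then have V_sub: "V \<beta> \<subseteq> ?fib I \<beta>" and "card (V \<beta>) = \<nu> \<beta>" for \<beta>
          by auto
        moreover have "?fib (\<Union>\<beta>. V \<beta>) \<beta> = V \<beta>" for \<beta>
          using V_sub by blast
        ultimately show "(\<Union>\<beta>. V \<beta>) \<in> {U. U \<subseteq> I \<and> (\<forall>\<beta>. card (?fib U \<beta>) = \<nu> \<beta>)}"
          by auto
      qed
      show "(\<lambda>\<beta>. ?fib (\<Union>\<beta>. V \<beta>) \<beta>) = V" if "V \<in> ?P" for V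
      proof
        fix \<beta>
        have "V \<gamma> \<subseteq> ?fib I \<gamma>" for \<gamma>
          using that by auto
        then show "?fib (\<Union>\<beta>. V \<beta>) \<beta> = V \<beta>"
          by blast
      qed
    qed auto
    ultimately have "card {U \<in> ?Z. (\<lambda>\<beta>. card (?fib U \<beta>)) = \<nu>} = card ?P"
      by (simp only: bij_betw_same_card)
    also have "\<dots> = (\<Prod>\<beta>\<in>UNIV. card {V. V \<subseteq> ?fib I \<beta> \<and> card V = \<nu> \<beta>})"
      by (rule card_PiE) simp
    finally show ?thesis
      using assms by (simp add: n_subsets)
  qed
  have "finite {\<nu>. \<forall>\<beta>. \<nu> \<beta> \<le> card (?fib I \<beta>)}"
  proof (rule finite_subset)
    show "{\<nu>. \<forall>\<beta>. \<nu> \<beta> \<le> card (?fib I \<beta>)} \<subseteq> (\<Pi>\<^sub>E \<beta>\<in>UNIV. {..card (?fib I \<beta>)})"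
      by auto
  qed (intro finite_PiE; simp)
  then have fin_N: "finite ?N"
    by (rule finite_subset[rotated]) auto
  have fin_Z: "finite ?Z"
    using assms by (intro finite_subset[of ?Z "Pow I"]) auto
  have "(\<lambda>U \<beta>. card (?fib U \<beta>)) ` ?Z \<subseteq> ?N"
    using sum_fib assms by (auto intro!: card_mono)
  then have "card ?Z = (\<Sum>\<nu>\<in>?N. card {U \<in> ?Z. (\<lambda>\<beta>. card (?fib U \<beta>)) = \<nu>})"
    using sum.group[OF fin_Z fin_N, of "\<lambda>U \<beta>. card (?fib U \<beta>)" "\<lambda>_. 1 :: nat"] by simp
  also have "\<dots> = (\<Sum>\<nu>\<in>?N. \<Prod>\<beta>\<in>UNIV. card (?fib I \<beta>) choose \<nu> \<beta>)"
    using fibre by (rule sum.cong[OF refl])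
  finally show ?thesis .
qed

text \<open>A binary word is determined by its support: its weight is the size of the support, and
  the parity check becomes a sum over the support. Indicator functions give the inverse map.\<close>

lemma D_count_eq_card_zero_sum_subsets:
  fixes e :: "nat \<Rightarrow> nat \<Rightarrow> 'a::finite_field"
  shows "D_count e m j = card {U. U \<subseteq> {1..(CARD('a) - 1) ^ m} \<and> card U = j
    \<and> (\<Sum>i\<in>U. tuple_sum m (e i)) = 0}"
proof -
  let ?I = "{1..(CARD('a) - 1) ^ m}"
  let ?g = "\<lambda>i. tuple_sum m (e i)"
  let ?supp = "\<lambda>u. {i \<in> ?I. u i \<noteq> 0}"
  have sum_supp: "(\<Sum>i\<in>?I. of_bit (u i) * ?g i) = sum ?g (?supp u)" for u
    unfolding sum.inter_filter[OF finite_atLeastAtMost]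
    by (intro sum.cong refl) auto
  have supp: "?supp (restrict (\<lambda>i. of_bool (i \<in> U)) ?I) = U" if "U \<subseteq> ?I" for U
    using that by auto
  have "bij_betw ?supp {u \<in> code_D e m. hamming_weight ((CARD('a) - 1) ^ m) u = j}
      {U. U \<subseteq> ?I \<and> card U = j \<and> sum ?g U = 0}"
  proof (rule bij_betwI[where g = "\<lambda>U. restrict (\<lambda>i. of_bool (i \<in> U)) ?I"])
    show "?supp \<in> {u \<in> code_D e m. hamming_weight ((CARD('a) - 1) ^ m) u = j}
        \<rightarrow> {U. U \<subseteq> ?I \<and> card U = j \<and> sum ?g U = 0}"
      unfolding code_D_def binary_code_def hamming_weight_def sum_supp by auto
    show "(\<lambda>U. restrict (\<lambda>i. of_bool (i \<in> U)) ?I) \<in> {U. U \<subseteq> ?I \<and> card U = j \<and> sum ?g U = 0}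
        \<rightarrow> {u \<in> code_D e m. hamming_weight ((CARD('a) - 1) ^ m) u = j}"
    proof (rule funcsetI)
      fix U
      assume "U \<in> {U. U \<subseteq> ?I \<and> card U = j \<and> sum ?g U = 0}"
      then have U: "U \<subseteq> ?I" "card U = j" "sum ?g U = 0"
        by simp_all
      show "restrict (\<lambda>i. of_bool (i \<in> U)) ?I
          \<in> {u \<in> code_D e m. hamming_weight ((CARD('a) - 1) ^ m) u = j}"
        unfolding code_D_def binary_code_def hamming_weight_def sum_supp mem_Collect_eq supp[OF U(1)]
        using U by simp
    qed
    show "restrict (\<lambda>i. of_bool (i \<in> ?supp u)) ?I = u"
      if "u \<in> {u \<in> code_D e m. hamming_weight ((CARD('a) - 1) ^ m) u = j}" for u
    proof
      fix i
      show "restrict (\<lambda>i. of_bool (i \<in> ?supp u)) ?I i = u i"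
        using that by (cases "u i") (auto simp: code_D_def binary_code_def PiE_def extensional_def)
    qed
  qed (use supp in auto)
  then show ?thesis
    unfolding D_count_def by (rule bij_betw_same_card)
qed

subsection \<open>Power moments\<close>

lemma prod_one_minus_sign:
  assumes "finite T" and "\<And>i. i \<in> T \<Longrightarrow> f i = 1 \<or> f i = (- 1 :: real)"
  shows "(\<Prod>i\<in>T. 1 - f i) = (if \<forall>i\<in>T. f i = - 1 then 2 ^ card T else 0)"
proof (cases "\<forall>i\<in>T. f i = - 1")
  case False
  then obtain i where "i \<in> T" "f i = 1"
    using assms by blast
  then show ?thesis
    using False \<open>finite T\<close> by (auto intro: prod_zero)
qed simp

text \<open>Binomial moments of the weights of the codewords \<open>(tr (a g\<^sub>1), \<dots>, tr (a g\<^sub>n))\<close>: a set \<open>T\<close>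
  of coordinates is contained in the support of such a codeword iff
  \<open>\<Prod>i\<in>T. (1 - \<lambda> (a g\<^sub>i)) / 2\<close> is \<open>1\<close> and not \<open>0\<close>; expanding the product and summing over \<open>a\<close>
  leaves the zero-sum subsets of \<open>T\<close>.\<close>

lemma sum_choose_weight:
  fixes g :: "'i \<Rightarrow> 'a::finite_field"
  assumes card: "CARD('a) = 2 ^ r" and r: "r \<ge> 1" and "finite I"
  shows "2 ^ t * (\<Sum>a\<in>UNIV. real (card {i \<in> I. add_char r (a * g i) = - 1} choose t))
    = 2 ^ r * (\<Sum>j=0..card I. (- 1) ^ j * real (card {U. U \<subseteq> I \<and> card U = j \<and> sum g U = 0})
        * real (choose_int (card I - j) (int (card I) - int t)))"
proof -
  let ?S = "\<lambda>a. {i \<in> I. add_char r (a * g i) = - 1}"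
  let ?c = "\<lambda>j. real (choose_int (card I - j) (int (card I) - int t))"
  define \<T> where "\<T> = {T. T \<subseteq> I \<and> card T = t}"
  have fin_T: "finite \<T>"
    unfolding \<T>_def using \<open>finite I\<close> by (auto intro: finite_subset[of _ "Pow I"])
  have fin: "finite T" if "T \<subseteq> I" for T
    using that \<open>finite I\<close> by (rule finite_subset)
  have expand: "2 ^ t * real (card (?S a) choose t)
      = (\<Sum>T\<in>\<T>. \<Sum>U\<in>Pow T. (- 1) ^ card U * add_char r (a * sum g U))" for a
  proof -
    have "card (?S a) choose t = card {T. T \<subseteq> ?S a \<and> card T = t}"
      using \<open>finite I\<close> by (simp add: n_subsets)
    also have "{T. T \<subseteq> ?S a \<and> card T = t} = \<T> \<inter> {T. \<forall>i\<in>T. add_char r (a * g i) = - 1}"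
      by (auto simp: \<T>_def)
    finally have "2 ^ t * real (card (?S a) choose t)
        = (\<Sum>T\<in>\<T>. if \<forall>i\<in>T. add_char r (a * g i) = - 1 then 2 ^ t else 0)"
      by (simp add: sum.If_cases[OF fin_T])
    also have "\<dots> = (\<Sum>T\<in>\<T>. \<Prod>i\<in>T. 1 - add_char r (a * g i))"
      using add_char_cases fin
      by (intro sum.cong refl, subst prod_one_minus_sign) (auto simp: \<T>_def)
    also have "\<dots> = (\<Sum>T\<in>\<T>. \<Sum>U\<in>Pow T. (- 1) ^ card U * add_char r (a * sum g U))"
      using fin
      by (intro sum.cong refl, subst prod_diff_conv_sum)
         (auto simp: \<T>_def sum_distrib_left add_char_sum[OF card])
    finally show ?thesis .
  qed
  have "2 ^ t * (\<Sum>a\<in>UNIV. real (card (?S a) choose t))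
      = (\<Sum>a\<in>UNIV. \<Sum>T\<in>\<T>. \<Sum>U\<in>Pow T. (- 1) ^ card U * add_char r (a * sum g U))"
    unfolding sum_distrib_left expand ..
  also have "\<dots> = (\<Sum>T\<in>\<T>. \<Sum>U\<in>Pow T. \<Sum>a\<in>UNIV. (- 1) ^ card U * add_char r (a * sum g U))"
    by (subst sum.swap, subst (2) sum.swap) (rule refl)
  also have "\<dots> = (\<Sum>T\<in>\<T>. \<Sum>U\<in>Pow T. (- 1) ^ card U * (if sum g U = 0 then 2 ^ r else 0))"
    unfolding sum_distrib_left[symmetric] sum_add_char_mult[OF card r] ..
  also have "\<dots> = (\<Sum>T\<in>\<T>. \<Sum>U | U \<in> Pow I \<and> U \<subseteq> T. (- 1) ^ card U * (if sum g U = 0 then 2 ^ r else 0))"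
    by (intro sum.cong refl) (auto simp: \<T>_def)
  \<comment> \<open>The summand does not involve \<open>T\<close>, so for fixed \<open>U\<close>
    only the number of \<open>t\<close>-sets between \<open>U\<close> and \<open>I\<close>
    enters.\<close>
  also have "\<dots> = (\<Sum>U\<in>Pow I. \<Sum>T | T \<in> \<T> \<and> U \<subseteq> T. (- 1) ^ card U * (if sum g U = 0 then 2 ^ r else 0))"
    by (rule sum.swap_restrict) (use fin_T \<open>finite I\<close> in auto)
  also have "\<dots> = (\<Sum>U\<in>Pow I. (- 1) ^ card U * (if sum g U = 0 then 2 ^ r else 0) * ?c (card U))"
  proof (rule sum.cong[OF refl])
    fix U assume "U \<in> Pow I"
    then have "card {T \<in> \<T>. U \<subseteq> T} = choose_int (card I - card U) (int (card I) - int t)"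
      using card_intermediate_subsets[OF \<open>finite I\<close>, of U t] by (simp add: \<T>_def conj_ac)
    then show "(\<Sum>T | T \<in> \<T> \<and> U \<subseteq> T. (- 1) ^ card U * (if sum g U = 0 then 2 ^ r else 0))
        = (- 1) ^ card U * (if sum g U = 0 then 2 ^ r else 0) * ?c (card U)"
      by simp
  qed
  also have "\<dots> = (\<Sum>j=0..card I. \<Sum>U | U \<in> Pow I \<and> card U = j.
      (- 1) ^ card U * (if sum g U = 0 then 2 ^ r else 0) * ?c (card U))"
    using \<open>finite I\<close> by (intro sum.group[symmetric]) (auto intro: card_mono)
  also have "\<dots> = (\<Sum>j=0..card I. 2 ^ r * ((- 1) ^ j * real (card {U. U \<subseteq> I \<and> card U = j \<and> sum g U = 0}) * ?c j))"
  proof (rule sum.cong[OF refl])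
    fix j
    have "(\<Sum>U | U \<in> Pow I \<and> card U = j. (- 1) ^ card U * (if sum g U = 0 then 2 ^ r else 0) * ?c (card U))
        = (\<Sum>U | U \<in> Pow I \<and> card U = j. if sum g U = 0 then (- 1) ^ j * 2 ^ r * ?c j else 0)"
      by (rule sum.cong) auto
    also have "\<dots> = (\<Sum>U | U \<subseteq> I \<and> card U = j \<and> sum g U = 0. (- 1) ^ j * 2 ^ r * ?c j)"
      using \<open>finite I\<close> by (subst sum.inter_filter[symmetric]) (simp_all add: conj_ac)
    finally show "(\<Sum>U | U \<in> Pow I \<and> card U = j. (- 1) ^ card U * (if sum g U = 0 then 2 ^ r else 0) * ?c (card U))
        = 2 ^ r * ((- 1) ^ j * real (card {U. U \<subseteq> I \<and> card U = j \<and> sum g U = 0}) * ?c j)"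
      by simp
  qed
  finally show ?thesis
    unfolding sum_distrib_left .
qed

text \<open>The Pless power moment identity: each power of a weight is expanded into binomial
  coefficients, whose sums over \<open>a\<close> are given by
  \<open>sum_choose_weight\<close>.\<close>

lemma sum_weight_power:
  fixes g :: "'i \<Rightarrow> 'a::finite_field"
  assumes card: "CARD('a) = 2 ^ r" and r: "r \<ge> 1" and I: "finite I"
  shows "2 ^ h * (\<Sum>a\<in>UNIV. real (card {i \<in> I. add_char r (a * g i) = - 1}) ^ h)
    = 2 ^ r * (\<Sum>j=0..min (card I) h. (- 1) ^ j * real (card {U. U \<subseteq> I \<and> card U = j \<and> sum g U = 0})
        * (\<Sum>t=j..h. fact t * stirling_S h t * 2 ^ (h - t)
             * real (choose_int (card I - j) (int (card I) - int t))))"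
proof -
  let ?w = "\<lambda>a. card {i \<in> I. add_char r (a * g i) = - 1}"
  let ?c = "\<lambda>j t. real (choose_int (card I - j) (int (card I) - int t))"
  let ?D = "\<lambda>j. (- 1) ^ j * real (card {U. U \<subseteq> I \<and> card U = j \<and> sum g U = 0})"
  let ?s = "\<lambda>t. fact t * stirling_S h t * 2 ^ (h - t)"
  \<comment> \<open>For \<open>t < j\<close> the lower argument exceeds the upper one, so the inner
    sum may start at \<open>t = j\<close>.\<close>
  have c_0: "?c j t = 0" if "t < j" "j \<le> card I" for j t
    using that by (simp add: choose_int_def nat_diff_distrib)
  have inner: "(\<Sum>t\<le>h. ?s t * ?c j t) = (\<Sum>t=j..h. ?s t * ?c j t)" if "j \<le> card I" for j
    using c_0 that by (intro sum.mono_neutral_right) auto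
  have "2 ^ h * (\<Sum>a\<in>UNIV. real (?w a) ^ h)
      = (\<Sum>t\<le>h. ?s t * (2 ^ t * (\<Sum>a\<in>UNIV. real (?w a choose t))))"
  proof -
    have "(\<Sum>a\<in>UNIV. real (?w a) ^ h)
        = (\<Sum>t\<le>h. fact t * stirling_S h t * (\<Sum>a\<in>UNIV. real (?w a choose t)))"
      unfolding power_eq_sum_stirling_S sum_distrib_left by (rule sum.swap)
    \<comment> \<open>Of the factor \<open>2 ^ h\<close>, the part \<open>2 ^ t\<close> is absorbed
      by the binomial moment and \<open>2 ^ (h - t)\<close> remains.\<close>
    moreover have "2 ^ h * (fact t * stirling_S h t * x) = ?s t * (2 ^ t * x)" if "t \<le> h" for t x
    proof -
      have "(2 :: real) ^ h = 2 ^ (h - t) * 2 ^ t"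
        using that by (simp flip: power_add)
      then show ?thesis
        by (simp only: mult_ac)
    qed
    ultimately show ?thesis
      by (simp only: sum_distrib_left[of "2 ^ h"]) (intro sum.cong refl, simp only: atMost_iff)
  qed
  also have "\<dots> = (\<Sum>t\<le>h. \<Sum>j=0..card I. 2 ^ r * (?D j * (?s t * ?c j t)))"
    unfolding sum_choose_weight[OF assms] by (simp add: sum_distrib_left mult_ac)
  also have "\<dots> = 2 ^ r * (\<Sum>j=0..card I. ?D j * (\<Sum>t\<le>h. ?s t * ?c j t))"
    by (subst sum.swap) (simp only: sum_distrib_left)
  also have "(\<Sum>j=0..card I. ?D j * (\<Sum>t\<le>h. ?s t * ?c j t))
      = (\<Sum>j=0..card I. ?D j * (\<Sum>t=j..h. ?s t * ?c j t))"
    using inner by (intro sum.cong refl) simp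
  \<comment> \<open>For \<open>j > h\<close> the inner sum is empty.\<close>
  also have "\<dots> = (\<Sum>j=0..min (card I) h. ?D j * (\<Sum>t=j..h. ?s t * ?c j t))"
    by (rule sum.mono_neutral_right) auto
  finally show ?thesis .
qed

section \<open>From weights to Kloosterman moments\<close>

lemma sum_eq_card_minus_weight:
  fixes f :: "'i \<Rightarrow> real"
  assumes "finite I" and "\<And>i. i \<in> I \<Longrightarrow> f i = 1 \<or> f i = - 1"
  shows "2 * real (card {i \<in> I. f i = - 1}) = real (card I) - sum f I"
proof -
  have "2 * real (card {i \<in> I. f i = - 1}) = (\<Sum>i\<in>I. if f i = - 1 then 2 else 0)"
    using \<open>finite I\<close> by (simp add: sum.If_cases Int_def)
  also have "\<dots> = (\<Sum>i\<in>I. 1 - f i)"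
    using assms(2) by (intro sum.cong refl) fastforce
  finally show ?thesis
    by (simp add: sum_subtractf)
qed

lemma MK_recursion:
  fixes e :: "nat \<Rightarrow> nat \<Rightarrow> 'a::finite_field"
  assumes card: "CARD('a) = 2 ^ r" and r: "r \<ge> 1"
    and e: "bij_betw e {1..(2 ^ r - 1) ^ m} (unit_tuples m)" and "h \<ge> 1"
  shows "MK TYPE('a) r (m * h) =
      (\<Sum>l=0..h - 1. (- 1) ^ (h + l + 1) * real (h choose l)
         * (2 ^ r - 1) ^ (m * (h - l)) * MK TYPE('a) r (m * l))
    + 2 ^ r * (\<Sum>j=0..min ((2 ^ r - 1) ^ m) h. (- 1) ^ (h + j) * real (D_count e m j)
         * (\<Sum>t=j..h. fact t * stirling_S h t * 2 ^ (h - t)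
              * real (choose_int ((2 ^ r - 1) ^ m - j) (int ((2 ^ r - 1) ^ m) - int t))))"
proof -
  let ?N = "(2 ^ r - 1) ^ m :: nat"
  let ?I = "{1..?N}"
  let ?g = "\<lambda>i. tuple_sum m (e i)"
  let ?K = "\<lambda>a :: 'a. kloosterman r a ^ m"
  let ?R = "\<Sum>j=0..min ?N h. (- 1) ^ j * real (D_count e m j)
         * (\<Sum>t=j..h. fact t * stirling_S h t * 2 ^ (h - t)
              * real (choose_int (?N - j) (int ?N - int t)))"
  define w where "w a = real (card {i \<in> ?I. add_char r (a * ?g i) = - 1})" for a :: 'a
  have w_0: "w 0 = 0"
    by (simp add: w_def add_char_0[OF card])
  have w: "2 * w a = real ?N - ?K a" if "a \<noteq> 0" for a
  proof -
    have "(\<Sum>i\<in>?I. add_char r (a * ?g i)) = (\<Sum>\<alpha>\<in>unit_tuples m. add_char r (a * tuple_sum m \<alpha>))"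
      by (rule sum.reindex_bij_betw[OF e])
    then show ?thesis
      unfolding w_def
      by (subst sum_eq_card_minus_weight)
         (simp_all add: add_char_cases sum_unit_tuples_add_char_mult_tuple_sum[OF card that])
  qed
  have MK: "(\<Sum>a\<in>UNIV - {0}. ?K a ^ l) = MK TYPE('a) r (m * l)" for l
    by (simp add: MK_def power_mult)
  let ?term = "\<lambda>l. (- 1) ^ l * real (h choose l) * real ?N ^ (h - l) * MK TYPE('a) r (m * l)"
  have "2 ^ r * ?R = 2 ^ h * (\<Sum>a\<in>UNIV. w a ^ h)"
    unfolding w_def sum_weight_power[OF card r finite_atLeastAtMost]
    by (simp add: D_count_eq_card_zero_sum_subsets card)
  \<comment> \<open>The term at \<open>a = 0\<close> is \<open>0 ^ h\<close>, which vanishes because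
    \<open>h \<ge> 1\<close>.\<close>
  also have "\<dots> = (\<Sum>a\<in>UNIV - {0}. (2 * w a) ^ h)"
    using \<open>h \<ge> 1\<close> by (subst sum.remove[of _ 0]) (simp_all add: w_0 power_0_left power_mult_distrib sum_distrib_left)
  also have "\<dots> = (\<Sum>a\<in>UNIV - {0}. (- ?K a + real ?N) ^ h)"
    using w by (intro sum.cong refl) simp
  also have "\<dots> = (\<Sum>a\<in>UNIV - {0}. \<Sum>l\<le>h. (- 1) ^ l * real (h choose l) * real ?N ^ (h - l) * ?K a ^ l)"
    unfolding binomial_ring by (simp add: power_minus[of "?K _"] mult_ac)
  also have "\<dots> = (\<Sum>l\<le>h. ?term l)"
    by (subst sum.swap) (simp only: MK sum_distrib_left[symmetric])
  \<comment> \<open>The top term \<open>l = h\<close> contains the wanted moment; multiplying by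
    \<open>(- 1) ^ h\<close> below clears its sign, and moving the lower terms across yields the
    signs \<open>(- 1) ^ (h + l + 1)\<close>.\<close>
  also have "\<dots> = (\<Sum>l=0..h - 1. ?term l) + (- 1) ^ h * MK TYPE('a) r (m * h)"
    using \<open>h \<ge> 1\<close> by (cases h) (simp_all add: atLeast0AtMost)
  finally have "(- 1) ^ h * (2 ^ r * ?R)
      = (- 1) ^ h * (\<Sum>l=0..h - 1. ?term l) + MK TYPE('a) r (m * h)"
    by (simp add: distrib_left)
  moreover have "real ?N ^ (h - l) = (2 ^ r - 1) ^ (m * (h - l))" for l
    by (simp add: of_nat_diff power_mult)
  ultimately show ?thesis
    by (simp add: sum_distrib_left power_add sum_negf mult_ac)
qed

theorem theorem1:
  fixes q r m :: nat
    and e :: "nat \<Rightarrow> nat \<Rightarrow> 'a::finite_field"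
  assumes "q = 2 ^ r" and "r \<ge> 3" and "CARD('a) = q" and "m \<ge> 1"
    and "bij_betw e {1..(q - 1) ^ m} (unit_tuples m)"
  shows "(\<forall>h\<ge>1. MK TYPE('a) r (m * h) =
            (\<Sum>l=0..h - 1. (- 1) ^ (h + l + 1) * real (h choose l)
               * (real q - 1) ^ (m * (h - l)) * MK TYPE('a) r (m * l))
          + real q * (\<Sum>j=0..min ((q - 1) ^ m) h. (- 1) ^ (h + j) * real (D_count e m j)
               * (\<Sum>t=j..h. fact t * stirling_S h t * 2 ^ (h - t)
                    * real (choose_int ((q - 1) ^ m - j) (int ((q - 1) ^ m) - int t)))))
       \<and> (\<forall>j. D_count e m j =
            (\<Sum>\<nu> | (\<forall>\<beta>. \<nu> \<beta> \<le> sigma m \<beta>) \<and> (\<Sum>\<beta>\<in>UNIV. \<nu> \<beta>) = j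
                 \<and> (\<Sum>\<beta>\<in>UNIV. of_nat (\<nu> \<beta>) * \<beta>) = (0::'a).
               \<Prod>\<beta>\<in>UNIV. sigma m \<beta> choose \<nu> \<beta>))
       \<and> (\<forall>\<beta>::'a. real (sigma m \<beta>) =
            (\<Sum>\<alpha> | \<alpha> \<in> unit_tuples m \<and> (\<Sum>i=1..m. inverse (\<alpha> i)) = \<beta>.
               add_char r (\<Sum>i=1..m. \<alpha> i))
          + inverse (real q) * ((real q - 1) ^ m + (- 1) ^ (m + 1)))"
proof (intro conjI allI impI)
  have card: "CARD('a) = 2 ^ r" and r: "r \<ge> 1"
    using assms by simp_all
  have e: "bij_betw e {1..(2 ^ r - 1) ^ m} (unit_tuples m)"
    using assms(1,5) by simp
  have q: "real q = 2 ^ r"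
    using assms(1) by simp
  show "MK TYPE('a) r (m * h) =
            (\<Sum>l=0..h - 1. (- 1) ^ (h + l + 1) * real (h choose l)
               * (real q - 1) ^ (m * (h - l)) * MK TYPE('a) r (m * l))
          + real q * (\<Sum>j=0..min ((q - 1) ^ m) h. (- 1) ^ (h + j) * real (D_count e m j)
               * (\<Sum>t=j..h. fact t * stirling_S h t * 2 ^ (h - t)
                    * real (choose_int ((q - 1) ^ m - j) (int ((q - 1) ^ m) - int t))))"
    if "h \<ge> 1" for h
    unfolding q unfolding assms(1) by (rule MK_recursion[OF card r e that])
  \<comment> \<open>The enumeration \<open>e\<close> carries fibres over the indices to fibres over
    the tuples, so the fibre sizes do not depend on the chosen ordering.\<close>
  have "card {i \<in> {1..(2 ^ r - 1) ^ m}. tuple_sum m (e i) = \<beta>} = sigma m \<beta>" for \<beta>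
  proof -
    have "bij_betw e {i \<in> {1..(2 ^ r - 1) ^ m}. tuple_sum m (e i) = \<beta>}
        {\<alpha> \<in> unit_tuples m. tuple_sum m \<alpha> = \<beta>}"
      by (rule bij_betw_subset[OF e]) (unfold bij_betw_imp_surj_on[OF e, symmetric], auto)
    then show ?thesis
      unfolding sigma_def by (rule bij_betw_same_card)
  qed
  then show "D_count e m j =
            (\<Sum>\<nu> | (\<forall>\<beta>. \<nu> \<beta> \<le> sigma m \<beta>) \<and> (\<Sum>\<beta>\<in>UNIV. \<nu> \<beta>) = j
                 \<and> (\<Sum>\<beta>\<in>UNIV. of_nat (\<nu> \<beta>) * \<beta>) = (0::'a).
               \<Prod>\<beta>\<in>UNIV. sigma m \<beta> choose \<nu> \<beta>)" for j
    unfolding D_count_eq_card_zero_sum_subsets card_zero_sum_subsets[OF finite_atLeastAtMost] card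
    by simp
  show "real (sigma m \<beta>) =
            (\<Sum>\<alpha> | \<alpha> \<in> unit_tuples m \<and> (\<Sum>i=1..m. inverse (\<alpha> i)) = \<beta>.
               add_char r (\<Sum>i=1..m. \<alpha> i))
          + inverse (real q) * ((real q - 1) ^ m + (- 1) ^ (m + 1))" for \<beta> :: 'a
    unfolding q by (rule sigma_eq_sum_add_char[OF card r])
qed

end
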